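(* Let $d\in\{1,2,3\}$, $a>0$, $s\in\mathbb{R}$, $h>0$, and let $V$ be a real-valued potential. Consider the nonlinear Schrödinger equation $i\,\partial_t\Psi+a\nabla^2\Psi-V\Psi+s|\Psi|^2\Psi=0$, discretized in space on a $d$-dimensional grid with spacing $h$ by either the second-order central difference (CD) scheme or the fourth-order two-step high-order compact (2SHOC) scheme, with Dirichlet, modulus-squared Dirichlet (MSD), Laplacian-zero, or periodic boundary conditions, and linearized by treating the nonlinear terms as constants; this gives the linear ODE system $\frac{d\vec\Psi}{dt}=\mathcal{A}\vec\Psi$ described in the context, with constants $L_i$ (one for each grid point $i$) and, in the non-periodic cases, $B_b$ (one for each boundary point $b$). Let $\vec G$ be the following finite set of numbers: - CD: for $d=1$, $\vec G=\{4,3,1,0\}$; for $d=2$, $\vec G=\{8,7,6,2,1,0\}$; for $d=3$, $\vec G=\{12,11,10,9,3,2,1,0\}$. - 2SHOC: for $d=1$, $\vec G=\frac1{12}\{64,63,46,12,-3,-4\}$; for $d=2$, $\vec G=\frac1{12}\{128,127,126,110,109,92,24,9,8,-6,-7,-8\}$; for $d=3$, $\vec G=\frac1{12}\{192,191,190,189,174,173,172,156,155,138,36,21,20,6,5,4,-9,-10,-11,-12\}$. If the time step $\mathbf{k}>0$ satisfies $$\mathbf{k}<\frac{\sqrt8}{\max\left\{\max_b|B_b|,\ \max_{i}\max_{g\in\vec G}|L_i-g|\right\}}\,\frac{h^2}{a},$$ where $i$ ranges over the entire grid, $b$ ranges over all boundary points, and the term $\max_b|B_b|$ is omitted in the periodic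 case, then the classical fourth-order Runge-Kutta (RK4) scheme applied to $\frac{d\vec\Psi}{dt}=\mathcal{A}\vec\Psi$ with time step $\mathbf{k}$ is stable.
   Context: Stability. For a linear system $\frac{d\vec\Psi}{dt}=\mathcal{A}\vec\Psi$, the RK4 scheme with time step $\mathbf{k}>0$ is called stable if $|R(\mathbf{k}\lambda)|\le 1$ for every eigenvalue $\lambda\in\mathbb{C}$ of $\mathcal{A}$, where $R(p)=1+p+\frac{p^2}{2}+\frac{p^3}{6}+\frac{p^4}{24}$. Grid. The grid is $\prod_{m=1}^d\{0,1,\dots,N_m-1\}$ with all $N_m\ge 3$, with the same spacing $h$ in every direction; $e_m$ denotes the $m$-th unit vector. In the periodic case all indices are taken modulo $N_m$ in direction $m$ and there are no boundary points. In the other cases a boundary point is a grid point having some coordinate equal to $0$ or $N_m-1$; the other points are interior. Linearization. The values $|\Psi_i|^2$ are replaced by fixed constants $U_i\ge 0$, and $V_i\in\mathbb{R}$ is the value of $V$ at grid point $i$. Set $$L_i=\frac{h^2}{a}\,(s\,U_i-V_i)$$ for every grid point $i$. Each boundary point $b$ carries two real constants $B_b$ and $\beta_b$, encoding the boundary condition in the forms $\partial_t\Psi_b=\frac{i_{\mathbb{C}}a}{h^2}B_b\Psi_b$ and $\nabla^2\Psi_b=\frac1{h^2}\beta_b\Psi_b$ ($i_{\mathbb{C}}$ is the imaginary unit): - Dirichlet ($\Psi_b=$ const): $B_b=0$, $\beta_b=\frac{h^2}{a}(V_b-sU_b)$. - Laplacian-zero ($\nabla^2\Psi_b=0$): $B_b=\frac{h^2}{a}(sU_b-V_b)$,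 $\beta_b=0$. - MSD ($|\Psi_b|^2=$ const): $B_b=\frac{h^2}{a}\,\mathrm{Im}\left[\frac{\partial_t\Psi_{b-1}}{\Psi_{b-1}}\right]$ and $\beta_b=h^2\left[\mathrm{Im}\left(i_{\mathbb{C}}\frac{\nabla^2\Psi_{b-1}}{\Psi_{b-1}}\right)+\frac1a(N_{b-1}-N_b)\right]$ with $N_j=sU_j-V_j$, where $b-1$ denotes the grid point one step inward from $b$ in the normal direction. In the linearization these are treated as fixed real constants independent of $\vec\Psi$ (so $B_b,\beta_b$ are arbitrary given real numbers). Semi-discrete system. At each point $i$ (each interior point in the non-periodic cases), $$\frac{d\Psi_i}{dt}=i_{\mathbb{C}}\,a\,(\Delta_h\Psi)_i+i_{\mathbb{C}}\,\frac{a}{h^2}L_i\Psi_i,$$ and at each boundary point $b$ (non-periodic cases) $\frac{d\Psi_b}{dt}=\frac{i_{\mathbb{C}}a}{h^2}B_b\Psi_b$. Collecting all grid values into a vector $\vec\Psi$ gives $\frac{d\vec\Psi}{dt}=\mathcal{A}\vec\Psi$. The discrete Laplacian $\Delta_h$ is one of the following. CD scheme: $(\Delta_h\Psi)_i=\frac{1}{h^2}\sum_{m=1}^d(\Psi_{i+e_m}-2\Psi_i+\Psi_{i-e_m})$. 2SHOC scheme: first set $D_i=\frac{1}{h^2}\sum_{m=1}^d(\Psi_{i+e_m}-2\Psi_i+\Psi_{i-e_m})$ at every point (every interior point in the non-periodic cases), and $D_b=\frac1{h^2}\beta_b\Psi_b$ at every boundary point $b$ in the non-periodic cases. Then $$(\Delta_h\Psi)_i=\frac{16-2d}{12}D_i-\frac1{12}\sum_{m=1}^d(D_{i+e_m}+D_{i-e_m})+\frac{1}{6h^2}\sum_{1\le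 m<n\le d}\ \sum_{\sigma,\tau\in\{1,-1\}}(\Psi_{i+\sigma e_m+\tau e_n}-\Psi_i),$$ the last sum being empty for $d=1$. *)

theory Defs
  imports Complex_Main "HOL-Library.FuncSet" "Jordan_Normal_Form.Char_Poly"
begin

text \<open>A grid point is a function on the directions \<open>{1..d}\<close>, extended by
  \<^const>\<open>undefined\<close> elsewhere (so that the grid is a finite set).  Coordinates are integers so
  that \<open>i - e\<^sub>m\<close> is not truncated.\<close>

type_synonym point = "nat \<Rightarrow> int"

datatype scheme = CD | SHOC2

text \<open>The MSD condition carries the real constants \<open>B\<^sub>b\<close> and \<open>\<beta>\<^sub>b\<close>, which the linearization treats
  as given and independent of the solution; for the other conditions they are determined, see
  \<open>bd_B\<close> and \<open>bd_beta\<close> below.\<close>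

datatype boundary_condition =
    Dirichlet
  | MSD "point \<Rightarrow> real" "point \<Rightarrow> real"
  | LaplacianZero
  | Periodic

definition grid :: "nat \<Rightarrow> (nat \<Rightarrow> nat) \<Rightarrow> point set" where
  "grid d N = (\<Pi>\<^sub>E m\<in>{1..d}. {0..int (N m) - 1})"

definition boundary :: "boundary_condition \<Rightarrow> nat \<Rightarrow> (nat \<Rightarrow> nat) \<Rightarrow> point set" where
  "boundary bc d N =
     (if bc = Periodic then {}
      else {i \<in> grid d N. \<exists>m\<in>{1..d}. i m = 0 \<or> i m = int (N m) - 1})"

text \<open>\<open>shift bc N m \<sigma> i\<close> is the point \<open>i + \<sigma> e\<^sub>m\<close>.\<close>

definition shift :: "boundary_condition \<Rightarrow> (nat \<Rightarrow> nat) \<Rightarrow> nat \<Rightarrow> int \<Rightarrow> point \<Rightarrow> point" where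
  "shift bc N m \<sigma> i =
     i(m := (if bc = Periodic then (i m + \<sigma>) mod int (N m) else i m + \<sigma>))"

definition L_coeff :: "real \<Rightarrow> real \<Rightarrow> real \<Rightarrow> (point \<Rightarrow> real) \<Rightarrow> (point \<Rightarrow> real) \<Rightarrow> point \<Rightarrow> real" where
  "L_coeff a s h U V i = h\<^sup>2 / a * (s * U i - V i)"

text \<open>The values in the periodic case are irrelevant, since there are no boundary points.\<close>

definition bd_B :: "boundary_condition \<Rightarrow> real \<Rightarrow> real \<Rightarrow> real \<Rightarrow> (point \<Rightarrow> real) \<Rightarrow> (point \<Rightarrow> real)
    \<Rightarrow> point \<Rightarrow> real" where
  "bd_B bc a s h U V b =
     (case bc of
        Dirichlet \<Rightarrow> 0
      | MSD B \<beta> \<Rightarrow> B b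
      | LaplacianZero \<Rightarrow> h\<^sup>2 / a * (s * U b - V b)
      | Periodic \<Rightarrow> 0)"

definition bd_beta :: "boundary_condition \<Rightarrow> real \<Rightarrow> real \<Rightarrow> real \<Rightarrow> (point \<Rightarrow> real) \<Rightarrow> (point \<Rightarrow> real)
    \<Rightarrow> point \<Rightarrow> real" where
  "bd_beta bc a s h U V b =
     (case bc of
        Dirichlet \<Rightarrow> h\<^sup>2 / a * (V b - s * U b)
      | MSD B \<beta> \<Rightarrow> \<beta> b
      | LaplacianZero \<Rightarrow> 0
      | Periodic \<Rightarrow> 0)"

definition lap_CD :: "boundary_condition \<Rightarrow> nat \<Rightarrow> (nat \<Rightarrow> nat) \<Rightarrow> real
    \<Rightarrow> (point \<Rightarrow> complex) \<Rightarrow> point \<Rightarrow> complex" where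
  "lap_CD bc d N h \<Psi> i =
     1 / (complex_of_real h)\<^sup>2 *
     (\<Sum>m\<in>{1..d}. \<Psi> (shift bc N m 1 i) - 2 * \<Psi> i + \<Psi> (shift bc N m (-1) i))"

definition shoc_D :: "boundary_condition \<Rightarrow> nat \<Rightarrow> (nat \<Rightarrow> nat) \<Rightarrow> real \<Rightarrow> real \<Rightarrow> real
    \<Rightarrow> (point \<Rightarrow> real) \<Rightarrow> (point \<Rightarrow> real) \<Rightarrow> (point \<Rightarrow> complex) \<Rightarrow> point \<Rightarrow> complex" where
  "shoc_D bc d N a s h U V \<Psi> i =
     (if i \<in> boundary bc d N
      then 1 / (complex_of_real h)\<^sup>2 * complex_of_real (bd_beta bc a s h U V i) * \<Psi> i
      else lap_CD bc d N h \<Psi> i)"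

definition lap_SHOC2 :: "boundary_condition \<Rightarrow> nat \<Rightarrow> (nat \<Rightarrow> nat) \<Rightarrow> real \<Rightarrow> real \<Rightarrow> real
    \<Rightarrow> (point \<Rightarrow> real) \<Rightarrow> (point \<Rightarrow> real) \<Rightarrow> (point \<Rightarrow> complex) \<Rightarrow> point \<Rightarrow> complex" where
  "lap_SHOC2 bc d N a s h U V \<Psi> i =
     (let D = shoc_D bc d N a s h U V \<Psi> in
      (16 - 2 * of_nat d) / 12 * D i
      - 1 / 12 * (\<Sum>m\<in>{1..d}. D (shift bc N m 1 i) + D (shift bc N m (-1) i))
      + 1 / (6 * (complex_of_real h)\<^sup>2) *
        (\<Sum>m\<in>{1..d}. \<Sum>n\<in>{m<..d}. \<Sum>\<sigma>\<in>{1, -1}. \<Sum>\<tau>\<in>{1, -1}.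
           \<Psi> (shift bc N n \<tau> (shift bc N m \<sigma> i)) - \<Psi> i))"

definition discrete_laplacian :: "scheme \<Rightarrow> boundary_condition \<Rightarrow> nat \<Rightarrow> (nat \<Rightarrow> nat)
    \<Rightarrow> real \<Rightarrow> real \<Rightarrow> real \<Rightarrow> (point \<Rightarrow> real) \<Rightarrow> (point \<Rightarrow> real)
    \<Rightarrow> (point \<Rightarrow> complex) \<Rightarrow> point \<Rightarrow> complex" where
  "discrete_laplacian sch bc d N a s h U V =
     (case sch of CD \<Rightarrow> lap_CD bc d N h | SHOC2 \<Rightarrow> lap_SHOC2 bc d N a s h U V)"

text \<open>The right-hand side of the linearized semi-discrete system.\<close>

definition semi_discrete_rhs :: "scheme \<Rightarrow> boundary_condition \<Rightarrow> nat \<Rightarrow> (nat \<Rightarrow> nat)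
    \<Rightarrow> real \<Rightarrow> real \<Rightarrow> real \<Rightarrow> (point \<Rightarrow> real) \<Rightarrow> (point \<Rightarrow> real)
    \<Rightarrow> (point \<Rightarrow> complex) \<Rightarrow> point \<Rightarrow> complex" where
  "semi_discrete_rhs sch bc d N a s h U V \<Psi> i =
     (if i \<in> boundary bc d N
      then \<i> * complex_of_real (a / h\<^sup>2) * complex_of_real (bd_B bc a s h U V i) * \<Psi> i
      else \<i> * complex_of_real a * discrete_laplacian sch bc d N a s h U V \<Psi> i
           + \<i> * complex_of_real (a / h\<^sup>2) * complex_of_real (L_coeff a s h U V i) * \<Psi> i)"

text \<open>The list \<open>pts\<close> enumerates the grid points, i.e. fixes the order in which the grid values are
  collected into a vector.  Column \<open>q\<close> of the matrix is the right-hand side applied to the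
  \<open>q\<close>-th unit grid function.\<close>

definition system_matrix :: "point list \<Rightarrow> scheme \<Rightarrow> boundary_condition \<Rightarrow> nat \<Rightarrow> (nat \<Rightarrow> nat)
    \<Rightarrow> real \<Rightarrow> real \<Rightarrow> real \<Rightarrow> (point \<Rightarrow> real) \<Rightarrow> (point \<Rightarrow> real) \<Rightarrow> complex mat" where
  "system_matrix pts sch bc d N a s h U V =
     mat (length pts) (length pts)
       (\<lambda>(p, q). semi_discrete_rhs sch bc d N a s h U V
                   (\<lambda>j. if j = pts ! q then 1 else 0) (pts ! p))"

definition rk4_R :: "complex \<Rightarrow> complex" where
  "rk4_R p = 1 + p + p\<^sup>2 / 2 + p ^ 3 / 6 + p ^ 4 / 24"

definition rk4_stable :: "complex mat \<Rightarrow> real \<Rightarrow> bool" where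
  "rk4_stable A k \<longleftrightarrow> (\<forall>z. eigenvalue A z \<longrightarrow> cmod (rk4_R (complex_of_real k * z)) \<le> 1)"

text \<open>Only used for dimensions 1, 2 and 3.\<close>

definition G_set :: "scheme \<Rightarrow> nat \<Rightarrow> real set" where
  "G_set sch d =
     (case sch of
        CD \<Rightarrow>
          (if d = 1 then {4, 3, 1, 0}
           else if d = 2 then {8, 7, 6, 2, 1, 0}
           else {12, 11, 10, 9, 3, 2, 1, 0})
      | SHOC2 \<Rightarrow>
          (\<lambda>x. 1 / 12 * x) `
          (if d = 1 then {64, 63, 46, 12, -3, -4}
           else if d = 2 then {128, 127, 126, 110, 109, 92, 24, 9, 8, -6, -7, -8}
           else {192, 191, 190, 189, 174, 173, 172, 156, 155, 138, 36, 21, 20, 6, 5, 4,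
                 -9, -10, -11, -12}))"

definition bound_max :: "scheme \<Rightarrow> boundary_condition \<Rightarrow> nat \<Rightarrow> (nat \<Rightarrow> nat)
    \<Rightarrow> real \<Rightarrow> real \<Rightarrow> real \<Rightarrow> (point \<Rightarrow> real) \<Rightarrow> (point \<Rightarrow> real) \<Rightarrow> real" where
  "bound_max sch bc d N a s h U V =
     (let ML = (MAX i\<in>grid d N. MAX g\<in>G_set sch d. \<bar>L_coeff a s h U V i - g\<bar>) in
      if bc = Periodic then ML
      else max (MAX b\<in>boundary bc d N. \<bar>bd_B bc a s h U V b\<bar>) ML)"

text \<open>The system matrix does represent the semi-discrete right-hand side.\<close>

lemma shift_in_grid:
  assumes "i \<in> grid d N" "m \<in> {1..d}" "\<sigma> = 1 \<or> \<sigma> = -1" "\<forall>m\<in>{1..d}. N m \<ge> 3"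
    "i \<notin> boundary bc d N"
  shows "shift bc N m \<sigma> i \<in> grid d N"
proof -
  have N: "N m \<ge> 3" using assms by auto
  have r: "i m \<in> {0..int (N m) - 1}" using assms(1,2) unfolding grid_def by (rule PiE_mem)
  have "(if bc = Periodic then (i m + \<sigma>) mod int (N m) else i m + \<sigma>) \<in> {0..int (N m) - 1}"
  proof (cases "bc = Periodic")
    case True
    have "0 \<le> (i m + \<sigma>) mod int (N m)" "(i m + \<sigma>) mod int (N m) < int (N m)"
      using N by simp_all
    then show ?thesis using True by simp
  next
    case False
    then have "i m \<noteq> 0" "i m \<noteq> int (N m) - 1" using assms(1,2,5) by (auto simp: boundary_def)
    then show ?thesis using r assms(3) False by auto
  qed
  then show ?thesis using assms(1,2) unfolding grid_def shift_def
    by (auto simp: PiE_iff extensional_def)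
qed

lemma shift2_in_grid:
  assumes "i \<in> grid d N" "m \<in> {1..d}" "\<sigma> = 1 \<or> \<sigma> = -1" "\<forall>m\<in>{1..d}. N m \<ge> 3"
    "i \<notin> boundary bc d N" "n \<in> {1..d}" "\<tau> = 1 \<or> \<tau> = -1" "m \<noteq> n"
  shows "shift bc N n \<tau> (shift bc N m \<sigma> i) \<in> grid d N"
proof -
  have 1: "shift bc N m \<sigma> i \<in> grid d N" using assms by (intro shift_in_grid)
  have 2: "shift bc N n \<tau> i \<in> grid d N" using assms by (intro shift_in_grid)
  have eq: "shift bc N n \<tau> (shift bc N m \<sigma> i) = (shift bc N m \<sigma> i)(n := shift bc N n \<tau> i n)"
    using assms(8) by (simp add: shift_def)
  have "shift bc N n \<tau> i n \<in> {0..int (N n) - 1}"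
    using 2 assms(6) unfolding grid_def by (rule PiE_mem)
  then show ?thesis unfolding eq using 1 assms(6) unfolding grid_def
    by (auto simp: PiE_iff extensional_def)
qed

lemma semi_discrete_rhs_local:
  assumes N: "\<forall>m\<in>{1..d}. N m \<ge> 3" and i: "i \<in> grid d N"
    and eq: "\<And>j. j \<in> grid d N \<Longrightarrow> \<Phi> j = \<Psi> j"
  shows "semi_discrete_rhs sch bc d N a s h U V \<Phi> i = semi_discrete_rhs sch bc d N a s h U V \<Psi> i"
proof -
  have lap: "lap_CD bc d N h \<Phi> j = lap_CD bc d N h \<Psi> j"
    if "j \<in> grid d N" "j \<notin> boundary bc d N" for j
    unfolding lap_CD_def using that N
    by (intro arg_cong2[where f = "(*)"] refl sum.cong) (simp add: eq shift_in_grid)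
  have D: "shoc_D bc d N a s h U V \<Phi> j = shoc_D bc d N a s h U V \<Psi> j" if "j \<in> grid d N" for j
    unfolding shoc_D_def using that lap eq by simp
  have shoc: "lap_SHOC2 bc d N a s h U V \<Phi> i = lap_SHOC2 bc d N a s h U V \<Psi> i"
    if nb: "i \<notin> boundary bc d N"
  proof -
    have 1: "(\<Sum>m\<in>{1..d}. shoc_D bc d N a s h U V \<Phi> (shift bc N m 1 i)
                + shoc_D bc d N a s h U V \<Phi> (shift bc N m (-1) i)) =
             (\<Sum>m\<in>{1..d}. shoc_D bc d N a s h U V \<Psi> (shift bc N m 1 i)
                + shoc_D bc d N a s h U V \<Psi> (shift bc N m (-1) i))"
      using nb N i by (intro sum.cong refl) (simp add: D shift_in_grid)
    have 2: "(\<Sum>m\<in>{1..d}. \<Sum>n\<in>{m<..d}. \<Sum>\<sigma>\<in>{1, -1}. \<Sum>\<tau>\<in>{1, -1}.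
           \<Phi> (shift bc N n \<tau> (shift bc N m \<sigma> i)) - \<Phi> i) =
          (\<Sum>m\<in>{1..d}. \<Sum>n\<in>{m<..d}. \<Sum>\<sigma>\<in>{1, -1}. \<Sum>\<tau>\<in>{1, -1}.
           \<Psi> (shift bc N n \<tau> (shift bc N m \<sigma> i)) - \<Psi> i)"
      using nb N i by (intro sum.cong refl arg_cong2[where f = "(-)"] eq shift2_in_grid) auto
    show ?thesis unfolding lap_SHOC2_def Let_def 1 2 using D[OF i] by simp
  qed
  show ?thesis unfolding semi_discrete_rhs_def discrete_laplacian_def
    using lap[OF i] shoc eq[OF i] by (cases sch) auto
qed

lemma semi_discrete_rhs_linear:
  fixes c :: "nat \<Rightarrow> complex"
  assumes "finite S"
  shows "semi_discrete_rhs sch bc d N a s h U V (\<lambda>j. \<Sum>q\<in>S. c q * f q j) i =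
    (\<Sum>q\<in>S. c q * semi_discrete_rhs sch bc d N a s h U V (f q) i)"
proof -
  have add: "semi_discrete_rhs sch bc d N a s h U V (\<lambda>j. x * \<Phi> j + \<Psi> j) i =
     x * semi_discrete_rhs sch bc d N a s h U V \<Phi> i + semi_discrete_rhs sch bc d N a s h U V \<Psi> i"
    for x \<Phi> \<Psi>
  proof -
    have lap: "lap_CD bc d N h (\<lambda>j. x * \<Phi> j + \<Psi> j) j
        = x * lap_CD bc d N h \<Phi> j + lap_CD bc d N h \<Psi> j" for j
      unfolding lap_CD_def
      by (simp add: sum_distrib_left sum.distrib sum_subtractf algebra_simps
          flip: sum.distrib sum_subtractf)
    have D: "shoc_D bc d N a s h U V (\<lambda>j. x * \<Phi> j + \<Psi> j) j
        = x * shoc_D bc d N a s h U V \<Phi> j + shoc_D bc d N a s h U V \<Psi> j" for j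
      unfolding shoc_D_def lap by (simp add: algebra_simps add_divide_distrib)
    have cr: "(\<Sum>m\<in>{1..d}. \<Sum>n\<in>{m<..d}. \<Sum>\<sigma>\<in>{1, -1}. \<Sum>\<tau>\<in>{1, -1}.
           (x * \<Phi> (shift bc N n \<tau> (shift bc N m \<sigma> i)) + \<Psi> (shift bc N n \<tau> (shift bc N m \<sigma> i)))
             - (x * \<Phi> i + \<Psi> i)) =
        x * (\<Sum>m\<in>{1..d}. \<Sum>n\<in>{m<..d}. \<Sum>\<sigma>\<in>{1, -1}. \<Sum>\<tau>\<in>{1, -1}.
           \<Phi> (shift bc N n \<tau> (shift bc N m \<sigma> i)) - \<Phi> i) +
        (\<Sum>m\<in>{1..d}. \<Sum>n\<in>{m<..d}. \<Sum>\<sigma>\<in>{1, -1}. \<Sum>\<tau>\<in>{1, -1}.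
           \<Psi> (shift bc N n \<tau> (shift bc N m \<sigma> i)) - \<Psi> i)"
      unfolding sum_distrib_left sum.distrib[symmetric]
      by (intro sum.cong refl) (simp add: algebra_simps)
    have Ds: "(\<Sum>m\<in>{1..d}. (x * shoc_D bc d N a s h U V \<Phi> (shift bc N m 1 i)
                 + shoc_D bc d N a s h U V \<Psi> (shift bc N m 1 i))
                + (x * shoc_D bc d N a s h U V \<Phi> (shift bc N m (-1) i)
                 + shoc_D bc d N a s h U V \<Psi> (shift bc N m (-1) i))) =
             x * (\<Sum>m\<in>{1..d}. shoc_D bc d N a s h U V \<Phi> (shift bc N m 1 i)
                + shoc_D bc d N a s h U V \<Phi> (shift bc N m (-1) i)) +
             (\<Sum>m\<in>{1..d}. shoc_D bc d N a s h U V \<Psi> (shift bc N m 1 i)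
                + shoc_D bc d N a s h U V \<Psi> (shift bc N m (-1) i))"
      unfolding sum_distrib_left sum.distrib[symmetric]
      by (intro sum.cong refl) (simp add: algebra_simps)
    have shoc: "lap_SHOC2 bc d N a s h U V (\<lambda>j. x * \<Phi> j + \<Psi> j) i
        = x * lap_SHOC2 bc d N a s h U V \<Phi> i + lap_SHOC2 bc d N a s h U V \<Psi> i"
      unfolding lap_SHOC2_def Let_def D cr Ds by (simp add: ring_distribs mult_ac)
    show ?thesis unfolding semi_discrete_rhs_def discrete_laplacian_def
      by (cases sch; cases "i \<in> boundary bc d N")
        (simp_all only: scheme.case if_True if_False lap shoc, simp_all only: ring_distribs mult_ac add_ac)
  qed
  have zero: "semi_discrete_rhs sch bc d N a s h U V (\<lambda>j. 0) i = 0"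
    using add[of "-1" "\<lambda>j. 0" "\<lambda>j. 0"] by simp
  show ?thesis using assms by (induction S) (simp_all add: zero add)
qed

lemma system_matrix_mult_vec:
  assumes "\<forall>m\<in>{1..d}. N m \<ge> 3" and "distinct pts" and "set pts = grid d N"
  shows "system_matrix pts sch bc d N a s h U V *\<^sub>v vec (length pts) (\<lambda>p. \<Psi> (pts ! p)) =
         vec (length pts) (\<lambda>p. semi_discrete_rhs sch bc d N a s h U V \<Psi> (pts ! p))"
proof (rule eq_vecI)
  fix p assume "p < dim_vec (vec (length pts)
    (\<lambda>p. semi_discrete_rhs sch bc d N a s h U V \<Psi> (pts ! p)))"
  then have p: "p < length pts" by simp
  let ?e = "\<lambda>q j. if j = pts ! q then 1 else 0 :: complex"
  let ?\<Phi> = "\<lambda>j. \<Sum>q\<in>{0..<length pts}. \<Psi> (pts ! q) * ?e q j"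
  have \<Phi>: "?\<Phi> j = \<Psi> j" if j: "j \<in> grid d N" for j
  proof -
    obtain r where r: "r < length pts" "j = pts ! r"
      using j assms(3) by (metis in_set_conv_nth)
    have "?\<Phi> j = (\<Sum>q\<in>{0..<length pts}. if q = r then \<Psi> (pts ! r) else 0)"
      by (rule sum.cong) (use r assms(2) in \<open>auto simp: nth_eq_iff_index_eq\<close>)
    then show ?thesis using r by simp
  qed
  have pg: "pts ! p \<in> grid d N" using p assms(3) nth_mem by blast
  have "semi_discrete_rhs sch bc d N a s h U V \<Psi> (pts ! p) =
        semi_discrete_rhs sch bc d N a s h U V ?\<Phi> (pts ! p)"
    by (rule semi_discrete_rhs_local[OF assms(1) pg]) (simp only: \<Phi>)
  also have "\<dots> = (\<Sum>q\<in>{0..<length pts}. \<Psi> (pts ! q) *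
      semi_discrete_rhs sch bc d N a s h U V (?e q) (pts ! p))"
    by (rule semi_discrete_rhs_linear) simp
  finally show "(system_matrix pts sch bc d N a s h U V *\<^sub>v
      vec (length pts) (\<lambda>p. \<Psi> (pts ! p))) $ p =
      vec (length pts) (\<lambda>p. semi_discrete_rhs sch bc d N a s h U V \<Psi> (pts ! p)) $ p"
    using p by (simp add: system_matrix_def scalar_prod_def mult.commute)
qed (simp add: system_matrix_def)

end

(* An eigenvalue z whose eigenvector has a nonzero value at a boundary point b is i (a/h^2) B_b,
   since boundary rows are diagonal.  Otherwise the eigenvector vanishes on the boundary, and the interior operator is a
   function of the one-dimensional neighbour sums A_m restricted to the interior, which are
   self-adjoint and pairwise commuting with norm at most 2: the scaled Laplacian is
   sum_m (A_m - 2) for CD and sum_m (4/3 A_m - 1/12 A_m^2 - 7/3) for 2SHOC, the mixed products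
   A_m A_n cancelling against the corner terms.  Hence its Rayleigh quotients are real and lie in
   [-4d, 0] resp. [-64d/12, 4d/12], whose end points are, up to sign, the extreme elements of G.
   So z = i y with |k y| < sqrt 8, and |R(i y)|^2 = 1 - y^6 (8 - y^2) / 576. *)
theory Submission
  imports Defs
begin

section \<open>RK4 amplification on the imaginary axis\<close>

lemma cmod_rk4_R_imaginary_le_1:
  assumes "\<bar>y\<bar> \<le> sqrt 8"
  shows "cmod (rk4_R (\<i> * complex_of_real y)) \<le> 1"
proof -
  have y2: "y\<^sup>2 \<le> 8"
    using abs_le_square_iff[of y "sqrt 8"] assms by simp
  have p: "(\<i> * complex_of_real y)\<^sup>2 = complex_of_real (- y\<^sup>2)"
    "(\<i> * complex_of_real y) ^ 3 = \<i> * complex_of_real (- (y ^ 3))"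
    "(\<i> * complex_of_real y) ^ 4 = complex_of_real (y ^ 4)"
    by (simp_all add: power_mult_distrib power3_eq_cube[of \<i>] power4_eq_xxxx[of \<i>])
  have R: "rk4_R (\<i> * complex_of_real y) = Complex (1 - y\<^sup>2 / 2 + y ^ 4 / 24) (y - y ^ 3 / 6)"
    unfolding rk4_R_def p by (simp add: Complex_eq algebra_simps add_divide_distrib)
  \<comment> \<open>The terms of order two and four cancel because R agrees with exp through degree
    four and exp has modulus 1 on the imaginary axis.\<close>
  have "(cmod (rk4_R (\<i> * complex_of_real y)))\<^sup>2 = 1 - y ^ 6 * (8 - y\<^sup>2) / 576"
    unfolding R cmod_power2 complex.sel
    by (simp add: power2_eq_square power_numeral_reduce algebra_simps diff_divide_distrib)
  also have "\<dots> \<le> 1\<^sup>2"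
    using mult_nonneg_nonneg[of "y ^ 6" "8 - y\<^sup>2"] y2 by simp
  finally show ?thesis
    by (rule power2_le_imp_le) simp
qed

section \<open>Compressed neighbour sums: symmetry and norm\<close>

lemma cnj_mult_self: "cnj x * x = complex_of_real ((cmod x)\<^sup>2)"
  by (metis complex_norm_square mult.commute of_real_power)

text \<open>Neighbours outside \<open>I\<close> contribute nothing to \<open>nbr_sum I p q f\<close> for those \<open>f\<close> that vanish
  outside \<open>I\<close>; on these functions it is the compression of the neighbour sum to \<open>I\<close>.\<close>

definition nbr_sum :: "'p set \<Rightarrow> ('p \<Rightarrow> 'p) \<Rightarrow> ('p \<Rightarrow> 'p) \<Rightarrow> ('p \<Rightarrow> complex) \<Rightarrow> 'p \<Rightarrow> complex" where
  "nbr_sum I p q f i = (if i \<in> I then f (p i) + f (q i) else 0)"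

text \<open>The maps need to be mutually inverse only at points of \<open>I\<close>, and their
  images may leave \<open>I\<close>. This covers steps that run into a boundary as well as cyclic
  steps.\<close>

locale partial_shift =
  fixes I :: "'p set" and p q :: "'p \<Rightarrow> 'p"
  assumes finite_I: "finite I"
    and q_p: "i \<in> I \<Longrightarrow> q (p i) = i"
    and p_q: "i \<in> I \<Longrightarrow> p (q i) = i"
begin

abbreviation "A \<equiv> nbr_sum I p q"

text \<open>The compressed forward and backward shifts are adjoint: points whose image leaves
  \<open>I\<close> contribute 0, and on the remaining ones \<open>p\<close> and \<open>q\<close> are
  inverse bijections.\<close>

lemma sum_cnj_shift:
  assumes f: "\<And>i. i \<notin> I \<Longrightarrow> f i = 0" and g: "\<And>i. i \<notin> I \<Longrightarrow> g i = 0"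
  shows "(\<Sum>i\<in>I. cnj (f i) * g (p i)) = (\<Sum>i\<in>I. cnj (f (q i)) * g i)"
proof -
  have "(\<Sum>i\<in>I. cnj (f i) * g (p i)) = (\<Sum>i\<in>{i\<in>I. p i \<in> I}. cnj (f i) * g (p i))"
    by (rule sum.mono_neutral_right) (use finite_I g in auto)
  also have "\<dots> = (\<Sum>i\<in>{i\<in>I. q i \<in> I}. cnj (f (q i)) * g i)"
    by (rule sum.reindex_bij_witness[of _ q p]) (auto simp: q_p p_q)
  also have "\<dots> = (\<Sum>i\<in>I. cnj (f (q i)) * g i)"
    by (rule sum.mono_neutral_left) (use finite_I f in auto)
  finally show ?thesis .
qed

text \<open>The compressed shift is a contraction: \<open>p\<close> is injective on the points that
  stay in \<open>I\<close>, so the left side reindexes to a partial sum of the right one.\<close>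

lemma sum_norm_shift_le:
  assumes f: "\<And>i. i \<notin> I \<Longrightarrow> f i = (0::complex)"
  shows "(\<Sum>i\<in>I. (cmod (f (p i)))\<^sup>2) \<le> (\<Sum>i\<in>I. (cmod (f i))\<^sup>2)"
proof -
  have inj: "inj_on p {i\<in>I. p i \<in> I}"
    by (rule inj_onI) (metis (mono_tags, lifting) mem_Collect_eq q_p)
  have "(\<Sum>i\<in>I. (cmod (f (p i)))\<^sup>2) = (\<Sum>i\<in>{i\<in>I. p i \<in> I}. (cmod (f (p i)))\<^sup>2)"
    by (rule sum.mono_neutral_right) (use finite_I f in auto)
  also have "\<dots> = (\<Sum>i\<in>p ` {i\<in>I. p i \<in> I}. (cmod (f i))\<^sup>2)"
    using inj by (simp add: sum.reindex)
  also have "\<dots> \<le> (\<Sum>i\<in>I. (cmod (f i))\<^sup>2)"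
    by (rule sum_mono2) (use finite_I in auto)
  finally show ?thesis .
qed

end

text \<open>The hypotheses are symmetric in \<open>p\<close> and \<open>q\<close>, so each shift
  lemma also holds for the backward shift.\<close>

sublocale partial_shift \<subseteq> flip: partial_shift I q p
  by unfold_locales (simp_all add: finite_I q_p p_q)

context partial_shift
begin

lemma nbr_sum_selfadjoint:
  assumes f: "\<And>i. i \<notin> I \<Longrightarrow> f i = 0" and g: "\<And>i. i \<notin> I \<Longrightarrow> g i = 0"
  shows "(\<Sum>i\<in>I. cnj (f i) * A g i) = (\<Sum>i\<in>I. cnj (A f i) * g i)"
  using sum_cnj_shift[of f g, OF f g] flip.sum_cnj_shift[of f g, OF f g]
  by (simp add: nbr_sum_def ring_distribs sum.distrib)

text \<open>Two contractions are added, so the operator norm is at most 2; here this appears in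
  squared form.\<close>

lemma sum_norm_nbr_sum_le:
  assumes f: "\<And>i. i \<notin> I \<Longrightarrow> f i = (0::complex)"
  shows "(\<Sum>i\<in>I. (cmod (A f i))\<^sup>2) \<le> 4 * (\<Sum>i\<in>I. (cmod (f i))\<^sup>2)"
proof -
  have par: "(cmod (x + y))\<^sup>2 \<le> 2 * (cmod x)\<^sup>2 + 2 * (cmod y)\<^sup>2" for x y
  proof -
    have "(cmod (x + y))\<^sup>2 \<le> (cmod x + cmod y)\<^sup>2"
      by (intro power_mono norm_triangle_ineq) simp
    also have "\<dots> \<le> 2 * (cmod x)\<^sup>2 + 2 * (cmod y)\<^sup>2"
      using zero_le_power2[of "cmod x - cmod y"] unfolding power2_sum power2_diff by linarith
    finally show ?thesis .
  qed
  have "(\<Sum>i\<in>I. (cmod (A f i))\<^sup>2) \<le> (\<Sum>i\<in>I. 2 * (cmod (f (p i)))\<^sup>2 + 2 * (cmod (f (q i)))\<^sup>2)"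
    by (rule sum_mono) (simp add: nbr_sum_def par)
  also have "\<dots> = 2 * (\<Sum>i\<in>I. (cmod (f (p i)))\<^sup>2) + 2 * (\<Sum>i\<in>I. (cmod (f (q i)))\<^sup>2)"
    by (simp add: sum.distrib sum_distrib_left)
  finally show ?thesis
    using sum_norm_shift_le[of f, OF f] flip.sum_norm_shift_le[of f, OF f] by linarith
qed

lemma nbr_sum_form:
  assumes f: "\<And>i. i \<notin> I \<Longrightarrow> f i = 0"
  obtains \<alpha> where "(\<Sum>i\<in>I. cnj (f i) * A f i) = complex_of_real \<alpha>"
    and "\<bar>\<alpha>\<bar> \<le> 2 * (\<Sum>i\<in>I. (cmod (f i))\<^sup>2)"
proof
  let ?S = "\<Sum>i\<in>I. cnj (f i) * A f i"
  have "cnj ?S = ?S"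
    using nbr_sum_selfadjoint[of f f, OF f f] by (simp add: mult.commute)
  then show S: "?S = complex_of_real (Re ?S)"
    by (metis Reals_cnj_iff of_real_Re)
  have "\<bar>Re ?S\<bar> \<le> cmod ?S"
    by (rule abs_Re_le_cmod)
  also have "\<dots> \<le> (\<Sum>i\<in>I. cmod (cnj (f i) * A f i))"
    by (rule norm_sum)
  also have "\<dots> \<le> (\<Sum>i\<in>I. (cmod (f i))\<^sup>2 + (cmod (A f i))\<^sup>2 / 4)"
  proof (rule sum_mono)
    fix i
    \<comment> \<open>The weight 1/2 balances the norm bound 2: after summation both squares
      contribute at most one copy of the squared norm of \<open>f\<close>, which gives the factor
      2.\<close>
    have "0 \<le> (cmod (f i) - cmod (A f i) / 2)\<^sup>2"
      by simp
    then show "cmod (cnj (f i) * A f i) \<le> (cmod (f i))\<^sup>2 + (cmod (A f i))\<^sup>2 / 4"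
      by (simp add: norm_mult power2_diff power_divide)
  qed
  also have "\<dots> = (\<Sum>i\<in>I. (cmod (f i))\<^sup>2) + (\<Sum>i\<in>I. (cmod (A f i))\<^sup>2) / 4"
    by (simp add: sum.distrib sum_divide_distrib)
  also have "\<dots> \<le> 2 * (\<Sum>i\<in>I. (cmod (f i))\<^sup>2)"
    using sum_norm_nbr_sum_le[of f, OF f] by simp
  finally show "\<bar>Re ?S\<bar> \<le> 2 * (\<Sum>i\<in>I. (cmod (f i))\<^sup>2)" .
qed

text \<open>One factor moves across by self-adjointness; this is allowed because \<open>A f\<close>
  again vanishes outside \<open>I\<close>.\<close>

lemma nbr_sum_square_form:
  assumes f: "\<And>i. i \<notin> I \<Longrightarrow> f i = 0"
  shows "(\<Sum>i\<in>I. cnj (f i) * A (A f) i) = complex_of_real (\<Sum>i\<in>I. (cmod (A f i))\<^sup>2)"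
proof -
  have "(\<Sum>i\<in>I. cnj (f i) * A (A f) i) = (\<Sum>i\<in>I. cnj (A f i) * A f i)"
    by (rule nbr_sum_selfadjoint[of f, OF f]) (simp_all add: nbr_sum_def)
  also have "\<dots> = (\<Sum>i\<in>I. complex_of_real ((cmod (A f i))\<^sup>2))"
    by (simp only: cnj_mult_self)
  finally show ?thesis
    by simp
qed

end

section \<open>Quadratic forms of the scaled Laplacians and the Rayleigh quotient\<close>

lemma sum_form_CD:
  assumes ps: "\<And>m. m \<in> M \<Longrightarrow> partial_shift I (p m) (q m)"
    and f: "\<And>i. i \<notin> I \<Longrightarrow> f i = 0"
  obtains t where "(\<Sum>i\<in>I. cnj (f i) * (\<Sum>m\<in>M. nbr_sum I (p m) (q m) f i - 2 * f i))
      = complex_of_real t"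
    and "- (4 * real (card M) * (\<Sum>i\<in>I. (cmod (f i))\<^sup>2)) \<le> t" and "t \<le> 0"
proof -
  let ?n = "\<Sum>i\<in>I. (cmod (f i))\<^sup>2"
  have "\<exists>\<alpha>. (\<Sum>i\<in>I. cnj (f i) * nbr_sum I (p m) (q m) f i) = complex_of_real \<alpha> \<and> \<bar>\<alpha>\<bar> \<le> 2 * ?n"
    if "m \<in> M" for m
    using partial_shift.nbr_sum_form[of I "p m" "q m" f, OF ps[OF that] f] by metis
  then obtain \<alpha> where \<alpha>: "\<And>m. m \<in> M \<Longrightarrow>
      (\<Sum>i\<in>I. cnj (f i) * nbr_sum I (p m) (q m) f i) = complex_of_real (\<alpha> m)"
      "\<And>m. m \<in> M \<Longrightarrow> \<bar>\<alpha> m\<bar> \<le> 2 * ?n"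
    by metis
  have n: "(\<Sum>i\<in>I. cnj (f i) * f i) = complex_of_real ?n"
    by (simp add: cnj_mult_self)
  show ?thesis
  proof
    have "(\<Sum>i\<in>I. cnj (f i) * (\<Sum>m\<in>M. nbr_sum I (p m) (q m) f i - 2 * f i)) =
        (\<Sum>m\<in>M. (\<Sum>i\<in>I. cnj (f i) * nbr_sum I (p m) (q m) f i) - 2 * (\<Sum>i\<in>I. cnj (f i) * f i))"
      unfolding sum_distrib_left by (subst sum.swap)
        (simp add: sum_subtractf[symmetric] right_diff_distrib mult_ac)
    also have "\<dots> = complex_of_real (\<Sum>m\<in>M. \<alpha> m - 2 * ?n)"
      by (simp add: \<alpha>(1) n)
    finally show "(\<Sum>i\<in>I. cnj (f i) * (\<Sum>m\<in>M. nbr_sum I (p m) (q m) f i - 2 * f i)) =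
      complex_of_real (\<Sum>m\<in>M. \<alpha> m - 2 * ?n)" .
    \<comment> \<open>Each direction contributes its form \<alpha>, of size at most
      \<open>2 * ?n\<close>, shifted down by \<open>2 * ?n\<close>.\<close>
    have "- (4 * ?n) \<le> \<alpha> m - 2 * ?n" "\<alpha> m - 2 * ?n \<le> 0" if "m \<in> M" for m
      using \<alpha>(2)[OF that] by linarith+
    then show "- (4 * real (card M) * ?n) \<le> (\<Sum>m\<in>M. \<alpha> m - 2 * ?n)"
      and "(\<Sum>m\<in>M. \<alpha> m - 2 * ?n) \<le> 0"
      using sum_bounded_below[of M "- (4 * ?n)" "\<lambda>m. \<alpha> m - 2 * ?n"]
      by (auto intro: sum_nonpos simp: mult_ac)
  qed
qed

lemma sum_form_SHOC2:
  assumes ps: "\<And>m. m \<in> M \<Longrightarrow> partial_shift I (p m) (q m)"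
    and f: "\<And>i. i \<notin> I \<Longrightarrow> f i = 0"
  obtains t where "(\<Sum>i\<in>I. cnj (f i) * (\<Sum>m\<in>M. 4 / 3 * nbr_sum I (p m) (q m) f i
        - 1 / 12 * nbr_sum I (p m) (q m) (nbr_sum I (p m) (q m) f) i - 7 / 3 * f i))
      = complex_of_real t"
    and "- (16 / 3 * real (card M) * (\<Sum>i\<in>I. (cmod (f i))\<^sup>2)) \<le> t"
    and "t \<le> 1 / 3 * real (card M) * (\<Sum>i\<in>I. (cmod (f i))\<^sup>2)"
proof -
  let ?n = "\<Sum>i\<in>I. (cmod (f i))\<^sup>2"
  let ?A = "\<lambda>m. nbr_sum I (p m) (q m)"
  define \<nu> where "\<nu> m = (\<Sum>i\<in>I. (cmod (?A m f i))\<^sup>2)" for m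
  have "\<exists>\<alpha>. (\<Sum>i\<in>I. cnj (f i) * ?A m f i) = complex_of_real \<alpha> \<and> \<bar>\<alpha>\<bar> \<le> 2 * ?n"
    if "m \<in> M" for m
    using partial_shift.nbr_sum_form[of I "p m" "q m" f, OF ps[OF that] f] by metis
  then obtain \<alpha> where \<alpha>: "\<And>m. m \<in> M \<Longrightarrow>
      (\<Sum>i\<in>I. cnj (f i) * ?A m f i) = complex_of_real (\<alpha> m)"
      "\<And>m. m \<in> M \<Longrightarrow> \<bar>\<alpha> m\<bar> \<le> 2 * ?n"
    by metis
  have \<nu>: "(\<Sum>i\<in>I. cnj (f i) * ?A m (?A m f) i) = complex_of_real (\<nu> m)"
      "0 \<le> \<nu> m" "\<nu> m \<le> 4 * ?n" if "m \<in> M" for m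
    using partial_shift.nbr_sum_square_form[of I "p m" "q m" f, OF ps[OF that] f]
      partial_shift.sum_norm_nbr_sum_le[of I "p m" "q m" f, OF ps[OF that] f]
    by (auto simp: \<nu>_def intro: sum_nonneg)
  have n: "(\<Sum>i\<in>I. cnj (f i) * f i) = complex_of_real ?n"
    by (simp add: cnj_mult_self)
  let ?t = "\<lambda>m. 4 / 3 * \<alpha> m - 1 / 12 * \<nu> m - 7 / 3 * ?n"
  show ?thesis
  proof
    have "(\<Sum>i\<in>I. cnj (f i) * (\<Sum>m\<in>M. 4 / 3 * ?A m f i - 1 / 12 * ?A m (?A m f) i - 7 / 3 * f i)) =
        (\<Sum>m\<in>M. 4 / 3 * (\<Sum>i\<in>I. cnj (f i) * ?A m f i)
           - 1 / 12 * (\<Sum>i\<in>I. cnj (f i) * ?A m (?A m f) i) - 7 / 3 * (\<Sum>i\<in>I. cnj (f i) * f i))"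
      unfolding sum_distrib_left by (subst sum.swap)
        (simp add: sum_subtractf[symmetric] right_diff_distrib mult_ac)
    also have "\<dots> = complex_of_real (\<Sum>m\<in>M. ?t m)"
      by (simp add: \<alpha>(1) \<nu>(1) n)
    finally show "(\<Sum>i\<in>I. cnj (f i) * (\<Sum>m\<in>M. 4 / 3 * ?A m f i
        - 1 / 12 * ?A m (?A m f) i - 7 / 3 * f i)) = complex_of_real (\<Sum>m\<in>M. ?t m)" .
    \<comment> \<open>Linear and square part are estimated separately: -8/3 - 1/3 - 7/3 = -16/3
      below and 8/3 - 0 - 7/3 = 1/3 above. Treating them jointly would improve the upper end to 0,
      but 1/3 per direction is the value that \<open>G_set\<close> provides for.\<close>
    have "- (16 / 3 * ?n) \<le> ?t m" "?t m \<le> 1 / 3 * ?n" if "m \<in> M" for m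
      using \<alpha>(2)[OF that] \<nu>(2,3)[OF that] by linarith+
    then show "- (16 / 3 * real (card M) * ?n) \<le> (\<Sum>m\<in>M. ?t m)"
      and "(\<Sum>m\<in>M. ?t m) \<le> 1 / 3 * real (card M) * ?n"
      using sum_bounded_below[of M "- (16 / 3 * ?n)" ?t] sum_bounded_above[of M ?t "1 / 3 * ?n"]
      by (auto simp: mult_ac)
  qed
qed

text \<open>Pairing the eigenvalue equation with \<open>f\<close> gives \<mu> times the squared norm
  as \<open>t\<close> plus the L-weighted squared norm. The lower bound on \<open>t\<close> combines
  with \<open>L i - G \<ge> - K\<close>, the upper one with \<open>L i - g \<le> K\<close>, so \<mu>
  is real and at most \<open>K\<close> in size.\<close>

lemma rayleigh_bound:
  fixes f T :: "'p \<Rightarrow> complex" and L :: "'p \<Rightarrow> real"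
  assumes fin: "finite I" and nz: "j \<in> I" "f j \<noteq> 0"
    and eig: "\<And>i. i \<in> I \<Longrightarrow> \<mu> * f i = T i + complex_of_real (L i) * f i"
    and T: "(\<Sum>i\<in>I. cnj (f i) * T i) = complex_of_real t"
    and lo: "- (G * (\<Sum>i\<in>I. (cmod (f i))\<^sup>2)) \<le> t"
    and hi: "t \<le> - (g * (\<Sum>i\<in>I. (cmod (f i))\<^sup>2))"
    and KG: "\<And>i. i \<in> I \<Longrightarrow> \<bar>L i - G\<bar> \<le> K" and Kg: "\<And>i. i \<in> I \<Longrightarrow> \<bar>L i - g\<bar> \<le> K"
  obtains y where "\<mu> = complex_of_real y" "\<bar>y\<bar> \<le> K"
proof -
  let ?n = "\<Sum>i\<in>I. (cmod (f i))\<^sup>2"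
  let ?l = "\<Sum>i\<in>I. L i * (cmod (f i))\<^sup>2"
  have n: "?n > 0"
    using sum_pos2[OF fin nz(1), of "\<lambda>i. (cmod (f i))\<^sup>2"] nz(2) by simp
  have "\<mu> * complex_of_real ?n = (\<Sum>i\<in>I. cnj (f i) * (\<mu> * f i))"
    unfolding of_real_sum sum_distrib_left
    by (intro sum.cong refl) (simp only: cnj_mult_self[symmetric] mult_ac)
  also have "\<dots> = (\<Sum>i\<in>I. cnj (f i) * T i) + (\<Sum>i\<in>I. complex_of_real (L i) * (cnj (f i) * f i))"
    unfolding sum.distrib[symmetric] by (intro sum.cong refl) (simp add: eig algebra_simps)
  also have "\<dots> = complex_of_real (t + ?l)"
    unfolding T cnj_mult_self by simp
  finally have \<mu>: "\<mu> = complex_of_real ((t + ?l) / ?n)"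
    using n by (simp add: field_simps del: of_real_sum)
  have "(\<Sum>i\<in>I. (G - K) * (cmod (f i))\<^sup>2) \<le> ?l"
    by (intro sum_mono mult_right_mono) (use KG in fastforce)+
  moreover have "?l \<le> (\<Sum>i\<in>I. (g + K) * (cmod (f i))\<^sup>2)"
    by (intro sum_mono mult_right_mono) (use Kg in fastforce)+
  ultimately have "- (K * ?n) \<le> t + ?l" "t + ?l \<le> K * ?n"
    using lo hi unfolding sum_distrib_left[symmetric] by (simp_all add: algebra_simps)
  then have "\<bar>(t + ?l) / ?n\<bar> \<le> K"
    using n by (simp add: abs_le_iff pos_divide_le_eq pos_le_divide_eq minus_divide_left)
  then show ?thesis
    using that \<mu> by blast
qed

section \<open>Symmetric double sums, grid shifts and the interior\<close>

text \<open>Used twice: for the products of neighbour sums, and with all entries 1 to count the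
  pairs of directions. In the induction the new row and the new column agree by symmetry.\<close>

lemma double_sum_symmetric:
  fixes X :: "nat \<Rightarrow> nat \<Rightarrow> 'a::comm_semiring_1"
  assumes "\<And>m n. m \<in> {1..d} \<Longrightarrow> n \<in> {1..d} \<Longrightarrow> X m n = X n m"
  shows "(\<Sum>m\<in>{1..d}. \<Sum>n\<in>{1..d}. X m n) =
    (\<Sum>m\<in>{1..d}. X m m) + 2 * (\<Sum>m\<in>{1..d}. \<Sum>n\<in>{m<..d}. X m n)"
  using assms
proof (induction d)
  case (Suc d)
  have *: "{m<..Suc d} = insert (Suc d) {m<..d}" if "m \<in> {1..d}" for m
    using that by auto
  have up: "(\<Sum>m\<in>{1..d}. \<Sum>n\<in>{m<..Suc d}. X m n) =
      (\<Sum>m\<in>{1..d}. X m (Suc d)) + (\<Sum>m\<in>{1..d}. \<Sum>n\<in>{m<..d}. X m n)"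
    unfolding sum.distrib[symmetric] by (intro sum.cong refl) (simp add: *)
  have sym: "(\<Sum>n\<in>{1..d}. X (Suc d) n) = (\<Sum>m\<in>{1..d}. X m (Suc d))"
    by (intro sum.cong refl Suc.prems) auto
  have IH: "(\<Sum>m\<in>{1..d}. \<Sum>n\<in>{1..d}. X m n) =
    (\<Sum>m\<in>{1..d}. X m m) + 2 * (\<Sum>m\<in>{1..d}. \<Sum>n\<in>{m<..d}. X m n)"
    by (intro Suc.IH Suc.prems) auto
  show ?case
    using IH sym by (simp add: sum.distrib up[unfolded One_nat_def] mult_2 algebra_simps)
qed simp

lemma shift_commute:
  "m \<noteq> n \<Longrightarrow> shift bc N m \<sigma> (shift bc N n \<tau> i) = shift bc N n \<tau> (shift bc N m \<sigma> i)"
  by (auto simp: shift_def fun_upd_twist)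

lemma finite_grid: "finite (grid d N)"
  unfolding grid_def by (rule finite_PiE) auto

lemma boundary_subset_grid: "boundary bc d N \<subseteq> grid d N"
  by (auto simp: boundary_def)

text \<open>Grid membership matters in the periodic case, where going forth and back returns the
  coordinate reduced modulo \<open>N m\<close>.\<close>

lemma shift_shift_back:
  assumes "i \<in> grid d N" "m \<in> {1..d}"
  shows "shift bc N m (- \<sigma>) (shift bc N m \<sigma> i) = i"
proof -
  have "i m \<in> {0..int (N m) - 1}"
    using assms unfolding grid_def by (rule PiE_mem)
  then show ?thesis
    by (auto simp: shift_def mod_simps)
qed

text \<open>In the periodic case the boundary is empty and this is the whole grid.\<close>

definition interior :: "boundary_condition \<Rightarrow> nat \<Rightarrow> (nat \<Rightarrow> nat) \<Rightarrow> point set" where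
  "interior bc d N = grid d N - boundary bc d N"

definition dir_nbr_sum :: "boundary_condition \<Rightarrow> nat \<Rightarrow> (nat \<Rightarrow> nat) \<Rightarrow> nat
    \<Rightarrow> (point \<Rightarrow> complex) \<Rightarrow> point \<Rightarrow> complex" where
  "dir_nbr_sum bc d N m = nbr_sum (interior bc d N) (shift bc N m 1) (shift bc N m (-1))"

lemma partial_shift_interior:
  assumes "m \<in> {1..d}"
  shows "partial_shift (interior bc d N) (shift bc N m 1) (shift bc N m (-1))"
  by unfold_locales
    (use assms finite_grid shift_shift_back[of _ d N m bc 1] shift_shift_back[of _ d N m bc "-1"]
      in \<open>auto simp: interior_def\<close>)

text \<open>A step that leaves the interior makes its own coordinate extreme, since all others are
  those of the interior point \<open>i\<close>. A second step in another direction keeps that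
  coordinate. With periodic conditions no step leaves.\<close>

lemma shift_leaving_interior:
  assumes N: "\<forall>m\<in>{1..d}. N m \<ge> 3" and i: "i \<in> interior bc d N" and m: "m \<in> {1..d}"
    and \<sigma>: "\<sigma> = 1 \<or> \<sigma> = -1" and out: "shift bc N m \<sigma> i \<notin> interior bc d N" and mn: "m \<noteq> n"
  shows "shift bc N n \<tau> (shift bc N m \<sigma> i) \<notin> interior bc d N"
proof -
  have g: "shift bc N m \<sigma> i \<in> grid d N"
    using i m \<sigma> N by (intro shift_in_grid) (auto simp: interior_def)
  then have b: "shift bc N m \<sigma> i \<in> boundary bc d N"
    using out by (simp add: interior_def)
  then have np: "bc \<noteq> Periodic"
    by (auto simp: boundary_def)
  obtain l where l: "l \<in> {1..d}"
    "shift bc N m \<sigma> i l = 0 \<or> shift bc N m \<sigma> i l = int (N l) - 1"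
    using b np by (auto simp: boundary_def)
  have "l = m"
  proof (rule ccontr)
    assume "l \<noteq> m"
    then have "i \<in> boundary bc d N"
      using l i np by (auto simp: boundary_def shift_def interior_def)
    then show False
      using i by (simp add: interior_def)
  qed
  then show ?thesis
    using l m mn np by (auto simp: interior_def boundary_def shift_def)
qed

text \<open>The compression sets the inner sum to 0 at a neighbour outside the interior. Nothing is
  lost, because the corners reached through it are not interior either and \<open>f\<close> vanishes
  there. For \<open>m = n\<close> this would fail: the step back returns to
  \<open>i\<close>.\<close>

lemma dir_nbr_sum_corners:
  assumes N: "\<forall>m\<in>{1..d}. N m \<ge> 3" and i: "i \<in> interior bc d N" and m: "m \<in> {1..d}"
    and mn: "m \<noteq> n" and f: "\<And>j. j \<notin> interior bc d N \<Longrightarrow> f j = 0"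
  shows "dir_nbr_sum bc d N m (dir_nbr_sum bc d N n f) i =
    (\<Sum>\<sigma>\<in>{1, -1}. \<Sum>\<tau>\<in>{1, -1}. f (shift bc N n \<tau> (shift bc N m \<sigma> i)))"
proof -
  have "dir_nbr_sum bc d N n f (shift bc N m \<sigma> i) =
      (\<Sum>\<tau>\<in>{1, -1}. f (shift bc N n \<tau> (shift bc N m \<sigma> i)))" if "\<sigma> = 1 \<or> \<sigma> = -1" for \<sigma>
    using shift_leaving_interior[OF N i m that _ mn]
    by (auto simp: dir_nbr_sum_def nbr_sum_def f)
  then show ?thesis
    using i by (subst dir_nbr_sum_def) (simp add: nbr_sum_def)
qed

text \<open>Both products are sums of \<open>f\<close> over the same four corners, reached in
  different order.\<close>

lemma dir_nbr_sum_commute: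
  assumes N: "\<forall>m\<in>{1..d}. N m \<ge> 3" and i: "i \<in> interior bc d N"
    and m: "m \<in> {1..d}" and n: "n \<in> {1..d}"
    and f: "\<And>j. j \<notin> interior bc d N \<Longrightarrow> f j = 0"
  shows "dir_nbr_sum bc d N m (dir_nbr_sum bc d N n f) i =
    dir_nbr_sum bc d N n (dir_nbr_sum bc d N m f) i"
proof (cases "m = n")
  case False
  then show ?thesis
    using dir_nbr_sum_corners[where f = f, OF N i m _ f, of n]
      dir_nbr_sum_corners[where f = f, OF N i n _ f, of m]
    by (simp add: shift_commute[of n m])
qed simp

section \<open>The discrete Laplacians expressed by neighbour sums\<close>

lemma lap_CD_interior:
  assumes "i \<in> interior bc d N"
  shows "lap_CD bc d N h f i =
    1 / (complex_of_real h)\<^sup>2 * (\<Sum>m\<in>{1..d}. dir_nbr_sum bc d N m f i - 2 * f i)"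
  unfolding lap_CD_def dir_nbr_sum_def nbr_sum_def using assms
  by (simp add: algebra_simps)

text \<open>Summing D over neighbours produces every product of two neighbour sums. Each unordered
  mixed pair occurs twice with weight -1/12, which the corner weight 1/6 cancels, so only squares
  remain.\<close>

lemma lap_SHOC2_interior:
  assumes N: "\<forall>m\<in>{1..d}. N m \<ge> 3" and i: "i \<in> interior bc d N"
    and f: "\<And>j. j \<notin> interior bc d N \<Longrightarrow> f j = 0"
  shows "lap_SHOC2 bc d N a s h U V f i = 1 / (complex_of_real h)\<^sup>2 *
    (\<Sum>m\<in>{1..d}. 4 / 3 * dir_nbr_sum bc d N m f i
       - 1 / 12 * dir_nbr_sum bc d N m (dir_nbr_sum bc d N m f) i - 7 / 3 * f i)"
proof -
  let ?A = "dir_nbr_sum bc d N"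
  let ?H = "1 / (complex_of_real h)\<^sup>2"
  let ?D = "\<lambda>j. (\<Sum>n\<in>{1..d}. ?A n f j) - 2 * of_nat d * f j"
  let ?X = "\<lambda>m n. ?A m (?A n f) i"
  let ?S1 = "\<Sum>m\<in>{1..d}. ?A m f i"
  let ?Sd = "\<Sum>m\<in>{1..d}. ?X m m"
  let ?So = "\<Sum>m\<in>{1..d}. \<Sum>n\<in>{m<..d}. ?X m n"
  let ?P = "\<Sum>m\<in>{1..d}. \<Sum>n\<in>{m<..d}. (1::complex)"
  \<comment> \<open>At a boundary point both sides are 0, because \<open>f\<close> vanishes there
    and the compressed sums do as well. This removes the boundary constant
    \<open>bd_beta\<close>.\<close>
  have D: "shoc_D bc d N a s h U V f j = ?H * ?D j" if "j \<in> grid d N" for j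
  proof (cases "j \<in> boundary bc d N")
    case True
    then have "j \<notin> interior bc d N"
      by (simp add: interior_def)
    then show ?thesis
      using True f by (simp add: shoc_D_def dir_nbr_sum_def nbr_sum_def)
  next
    case False
    then have "j \<in> interior bc d N"
      using that by (simp add: interior_def)
    then show ?thesis
      using False by (simp add: shoc_D_def lap_CD_interior sum_subtractf)
  qed
  have ig: "i \<in> grid d N" "i \<notin> boundary bc d N"
    using i by (auto simp: interior_def)
  have "(\<Sum>m\<in>{1..d}. shoc_D bc d N a s h U V f (shift bc N m 1 i)
        + shoc_D bc d N a s h U V f (shift bc N m (-1) i))
      = (\<Sum>m\<in>{1..d}. ?H * ((\<Sum>n\<in>{1..d}. ?X m n) - 2 * of_nat d * ?A m f i))"
  proof (rule sum.cong[OF refl])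
    fix m assume m: "m \<in> {1..d}"
    \<comment> \<open>Adding the values at the two neighbours of an interior point is an application
      of \<open>?A m\<close>, here used for \<open>f\<close> and for each
      \<open>?A n f\<close>.\<close>
    have A: "?A m g i = g (shift bc N m 1 i) + g (shift bc N m (-1) i)" for g
      using i by (simp add: dir_nbr_sum_def nbr_sum_def)
    have "shift bc N m 1 i \<in> grid d N" "shift bc N m (-1) i \<in> grid d N"
      using ig m N by (auto intro!: shift_in_grid)
    then show "shoc_D bc d N a s h U V f (shift bc N m 1 i)
        + shoc_D bc d N a s h U V f (shift bc N m (-1) i)
      = ?H * ((\<Sum>n\<in>{1..d}. ?X m n) - 2 * of_nat d * ?A m f i)"
      unfolding A[of "dir_nbr_sum bc d N n f" for n] A[of f] sum.distrib
      by (simp only: D) (simp only: ring_distribs add_ac diff_conv_add_uminus minus_add_distrib)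
  qed
  also have "\<dots> = ?H * ((\<Sum>m\<in>{1..d}. \<Sum>n\<in>{1..d}. ?X m n) - 2 * of_nat d * ?S1)"
    by (simp add: sum_subtractf sum_distrib_left right_diff_distrib)
  also have "(\<Sum>m\<in>{1..d}. \<Sum>n\<in>{1..d}. ?X m n) = ?Sd + 2 * ?So"
    by (rule double_sum_symmetric) (rule dir_nbr_sum_commute[where f = f, OF N i _ _ f])
  finally have Ds: "(\<Sum>m\<in>{1..d}. shoc_D bc d N a s h U V f (shift bc N m 1 i)
        + shoc_D bc d N a s h U V f (shift bc N m (-1) i))
      = ?H * (?Sd + 2 * ?So - 2 * of_nat d * ?S1)" .
  have "(\<Sum>m\<in>{1..d}. \<Sum>n\<in>{m<..d}. \<Sum>\<sigma>\<in>{1, -1}. \<Sum>\<tau>\<in>{1, -1}.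
           f (shift bc N n \<tau> (shift bc N m \<sigma> i)) - f i)
      = (\<Sum>m\<in>{1..d}. \<Sum>n\<in>{m<..d}. ?X m n - 4 * f i * 1)"
  proof (intro sum.cong refl)
    fix m n assume "m \<in> {1..d}" "n \<in> {m<..d}"
    then show "(\<Sum>\<sigma>\<in>{1, -1}. \<Sum>\<tau>\<in>{1, -1}. f (shift bc N n \<tau> (shift bc N m \<sigma> i)) - f i)
      = ?X m n - 4 * f i * 1"
      using dir_nbr_sum_corners[where f = f, OF N i _ _ f, of m n] by simp
  qed
  also have "\<dots> = ?So - 4 * f i * ?P"
    unfolding sum_subtractf sum_distrib_left ..
  finally have cr: "(\<Sum>m\<in>{1..d}. \<Sum>n\<in>{m<..d}. \<Sum>\<sigma>\<in>{1, -1}. \<Sum>\<tau>\<in>{1, -1}.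
           f (shift bc N n \<tau> (shift bc N m \<sigma> i)) - f i) = ?So - 4 * f i * ?P" .
  \<comment> \<open>\<open>?P\<close> counts the pairs m < n, so this is d^2 = d + d(d-1); it makes
    the last term of \<open>ident\<close> vanish.\<close>
  have P: "of_nat d * of_nat d = of_nat d + 2 * ?P"
    using double_sum_symmetric[of d "\<lambda>m n. 1::complex"] by simp
  have H6: "1 / (6 * (complex_of_real h)\<^sup>2) = 1 / 6 * ?H"
    by simp
  \<comment> \<open>The coefficient of \<open>S1\<close> is (16-2d)/12 + 2d/12 = 4/3. For
    \<open>F\<close> it is -8d/3 + d^2/3 - 2P/3, which is -7d/3 once 2P = d^2 - d.\<close>
  have ident: "(16 - 2 * D) / 12 * (S1 - 2 * D * F) - 1 / 12 * (Sd + 2 * So - 2 * D * S1)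
      + 1 / 6 * (So - 4 * F * P) =
      4 / 3 * S1 - 1 / 12 * Sd - 7 / 3 * D * F + (D * D - D - 2 * P) * F / 3"
    for D S1 F Sd So P :: complex
    by (simp add: field_simps)
  have "lap_SHOC2 bc d N a s h U V f i = ?H * ((16 - 2 * of_nat d) / 12 * ?D i
      - 1 / 12 * (?Sd + 2 * ?So - 2 * of_nat d * ?S1) + 1 / 6 * (?So - 4 * f i * ?P))"
    unfolding lap_SHOC2_def Let_def Ds cr D[OF ig(1)] H6 by (simp only: ring_distribs mult_ac)
  also have "(16 - 2 * of_nat d) / 12 * ?D i
      - 1 / 12 * (?Sd + 2 * ?So - 2 * of_nat d * ?S1) + 1 / 6 * (?So - 4 * f i * ?P)
      = 4 / 3 * ?S1 - 1 / 12 * ?Sd - 7 / 3 * of_nat d * f i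
        + (of_nat d * of_nat d - of_nat d - 2 * ?P) * f i / 3"
    by (rule ident)
  also have "\<dots> = (\<Sum>m\<in>{1..d}. 4 / 3 * ?A m f i - 1 / 12 * ?X m m - 7 / 3 * f i)"
    unfolding P by (simp add: sum_subtractf sum_distrib_left)
  finally show ?thesis .
qed

section \<open>From the maximum in the time step bound to the spectrum and stability\<close>

lemma bound_max_ge_L:
  assumes "i \<in> grid d N" "g \<in> G_set sch d"
  shows "\<bar>L_coeff a s h U V i - g\<bar> \<le> bound_max sch bc d N a s h U V"
proof -
  have fin: "finite (G_set sch d)"
    by (cases sch) (simp_all add: G_set_def)
  have "\<bar>L_coeff a s h U V i - g\<bar> \<le> (MAX g\<in>G_set sch d. \<bar>L_coeff a s h U V i - g\<bar>)"
    by (rule Max_ge) (use fin assms in auto)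
  also have "\<dots> \<le> (MAX i\<in>grid d N. MAX g\<in>G_set sch d. \<bar>L_coeff a s h U V i - g\<bar>)"
    by (rule Max_ge) (use finite_grid assms in auto)
  finally show ?thesis
    by (auto simp: bound_max_def Let_def)
qed

lemma bound_max_ge_B:
  assumes "b \<in> boundary bc d N"
  shows "\<bar>bd_B bc a s h U V b\<bar> \<le> bound_max sch bc d N a s h U V"
proof -
  have "bc \<noteq> Periodic"
    using assms by (auto simp: boundary_def)
  moreover have "\<bar>bd_B bc a s h U V b\<bar> \<le> (MAX b\<in>boundary bc d N. \<bar>bd_B bc a s h U V b\<bar>)"
    by (rule Max_ge)
      (use finite_subset[OF boundary_subset_grid finite_grid] assms in auto)
  ultimately show ?thesis
    by (auto simp: bound_max_def Let_def)
qed

lemma interior_spectrum_bound: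
  assumes d: "d \<in> {1, 2, 3}" and N: "\<forall>m\<in>{1..d}. N m \<ge> 3" and a: "a > 0" and h: "h > 0"
    and f: "\<And>j. j \<notin> interior bc d N \<Longrightarrow> f j = 0"
    and j: "j \<in> interior bc d N" "f j \<noteq> 0"
    and eig: "\<And>i. i \<in> interior bc d N \<Longrightarrow> semi_discrete_rhs sch bc d N a s h U V f i = z * f i"
  obtains y where "z = \<i> * complex_of_real (a / h\<^sup>2 * y)"
    and "\<bar>y\<bar> \<le> bound_max sch bc d N a s h U V"
proof -
  let ?I = "interior bc d N"
  let ?n = "\<Sum>i\<in>?I. (cmod (f i))\<^sup>2"
  \<comment> \<open>Removing the factor i a/h^2 leaves an eigenvalue problem whose quadratic form is
    real.\<close>
  define \<mu> where "\<mu> = z / (\<i> * complex_of_real (a / h\<^sup>2))"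
  define T where "T i = (complex_of_real h)\<^sup>2 * discrete_laplacian sch bc d N a s h U V f i" for i
  have fin: "finite ?I"
    using finite_grid by (simp add: interior_def)
  have z: "z = \<i> * complex_of_real (a / h\<^sup>2) * \<mu>"
    using a h by (simp add: \<mu>_def)
  have \<mu>: "\<mu> * f i = T i + complex_of_real (L_coeff a s h U V i) * f i" if i: "i \<in> ?I" for i
  proof -
    have "\<i> * complex_of_real (a / h\<^sup>2) * (\<mu> * f i) =
        \<i> * complex_of_real (a / h\<^sup>2) * (T i + complex_of_real (L_coeff a s h U V i) * f i)"
      using eig[OF i] i h unfolding z T_def semi_discrete_rhs_def
      by (simp add: interior_def ring_distribs mult_ac)
    then show ?thesis
      using a h by simp
  qed
  have ps: "partial_shift ?I (shift bc N m 1) (shift bc N m (-1))" if "m \<in> {1..d}" for m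
    using that by (rule partial_shift_interior)
  \<comment> \<open>\<open>- G\<close> and \<open>- g\<close> enclose the Rayleigh quotient of
    \<open>T\<close>. Taking both from \<open>G_set\<close> lets \<open>bound_max\<close> control
    the distances of \<open>L_coeff\<close> to them.\<close>
  obtain G g t where G: "G \<in> G_set sch d" "g \<in> G_set sch d"
    and t: "(\<Sum>i\<in>?I. cnj (f i) * T i) = complex_of_real t" "- (G * ?n) \<le> t" "t \<le> - (g * ?n)"
  proof (cases sch)
    case CD
    have T: "T i = (\<Sum>m\<in>{1..d}. dir_nbr_sum bc d N m f i - 2 * f i)" if "i \<in> ?I" for i
      using that h by (simp add: T_def CD discrete_laplacian_def lap_CD_interior)
    obtain t where "(\<Sum>i\<in>?I. cnj (f i) * (\<Sum>m\<in>{1..d}. dir_nbr_sum bc d N m f i - 2 * f i))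
        = complex_of_real t" "- (4 * real (card {1..d}) * ?n) \<le> t" "t \<le> 0"
      by (rule sum_form_CD[where p = "\<lambda>m. shift bc N m 1" and q = "\<lambda>m. shift bc N m (-1)"
            and M = "{1..d}" and f = f, OF ps f, folded dir_nbr_sum_def])
    moreover have "4 * real d \<in> G_set sch d" "0 \<in> G_set sch d"
      using d by (auto simp: CD G_set_def)
    ultimately show ?thesis
      using that[of "4 * real d" 0 t] by (simp add: T)
  next
    case SHOC2
    have T: "T i = (\<Sum>m\<in>{1..d}. 4 / 3 * dir_nbr_sum bc d N m f i
       - 1 / 12 * dir_nbr_sum bc d N m (dir_nbr_sum bc d N m f) i - 7 / 3 * f i)"
      if "i \<in> ?I" for i
      using lap_SHOC2_interior[where f = f, OF N that f] h
      by (simp add: T_def SHOC2 discrete_laplacian_def)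
    obtain t where "(\<Sum>i\<in>?I. cnj (f i) * (\<Sum>m\<in>{1..d}. 4 / 3 * dir_nbr_sum bc d N m f i
       - 1 / 12 * dir_nbr_sum bc d N m (dir_nbr_sum bc d N m f) i - 7 / 3 * f i))
        = complex_of_real t" "- (16 / 3 * real (card {1..d}) * ?n) \<le> t"
        "t \<le> 1 / 3 * real (card {1..d}) * ?n"
      by (rule sum_form_SHOC2[where p = "\<lambda>m. shift bc N m 1" and q = "\<lambda>m. shift bc N m (-1)"
            and M = "{1..d}" and f = f, OF ps f, folded dir_nbr_sum_def])
    moreover have "16 / 3 * real d \<in> G_set sch d" "- (1 / 3 * real d) \<in> G_set sch d"
      using d by (auto simp: SHOC2 G_set_def)
    ultimately show ?thesis
      using that[of "16 / 3 * real d" "- (1 / 3 * real d)" t] by (simp add: T)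
  qed
  have K: "\<bar>L_coeff a s h U V i - \<gamma>\<bar> \<le> bound_max sch bc d N a s h U V"
    if "i \<in> ?I" "\<gamma> \<in> G_set sch d" for i \<gamma>
    using that by (intro bound_max_ge_L) (auto simp: interior_def)
  obtain y where "\<mu> = complex_of_real y" "\<bar>y\<bar> \<le> bound_max sch bc d N a s h U V"
    using rayleigh_bound[OF fin j \<mu> t K[OF _ G(1)] K[OF _ G(2)]] by blast
  then show ?thesis
    using that[of y] z by simp
qed

lemma eigenvalue_system_matrix:
  assumes N: "\<forall>m\<in>{1..d}. N m \<ge> 3" and pts: "distinct pts" "set pts = grid d N"
    and ev: "eigenvalue (system_matrix pts sch bc d N a s h U V) z"
  obtains f j where "j \<in> grid d N" "f j \<noteq> 0" "\<And>i. i \<notin> grid d N \<Longrightarrow> f i = 0"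
    "\<And>i. i \<in> grid d N \<Longrightarrow> semi_discrete_rhs sch bc d N a s h U V f i = z * f i"
proof -
  let ?M = "system_matrix pts sch bc d N a s h U V"
  let ?l = "length pts"
  obtain v where v: "v \<in> carrier_vec ?l" "v \<noteq> 0\<^sub>v ?l" "?M *\<^sub>v v = z \<cdot>\<^sub>v v"
    using ev by (auto simp: eigenvalue_def eigenvector_def system_matrix_def)
  \<comment> \<open>The eigenvector is read as a grid function through the inverse of the
    enumeration. The value 0 off the grid lets \<open>f\<close> later count as vanishing outside the
    interior.\<close>
  define f where "f i = (if i \<in> grid d N then v $ the_inv_into {..<?l} ((!) pts) i else 0)" for i
  have inj: "inj_on ((!) pts) {..<?l}"
    using pts(1) by (simp add: inj_on_nth)
  have f: "f (pts ! p) = v $ p" if "p < ?l" for p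
    using that pts(2) inj by (auto simp: f_def the_inv_into_f_f)
  have vf: "v = vec ?l (\<lambda>p. f (pts ! p))"
    using v(1) f by (intro eq_vecI) auto
  have eq: "vec ?l (\<lambda>p. semi_discrete_rhs sch bc d N a s h U V f (pts ! p)) = z \<cdot>\<^sub>v v"
    using v(3) system_matrix_mult_vec[OF N pts, of sch bc a s h U V f] unfolding vf[symmetric]
    by simp
  have "\<exists>p<?l. v $ p \<noteq> 0"
    using v(1,2) by (metis carrier_vecD eq_vecI index_zero_vec)
  then obtain p where p: "p < ?l" "v $ p \<noteq> 0"
    by blast
  show ?thesis
  proof
    show "pts ! p \<in> grid d N" "f (pts ! p) \<noteq> 0"
      using p f pts(2) nth_mem by auto
    show "f i = 0" if "i \<notin> grid d N" for i
      using that by (simp add: f_def)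
    show "semi_discrete_rhs sch bc d N a s h U V f i = z * f i" if "i \<in> grid d N" for i
    proof -
      obtain r where r: "r < ?l" "i = pts ! r"
        using \<open>i \<in> grid d N\<close> pts(2) by (metis in_set_conv_nth)
      then show ?thesis
        using arg_cong[OF eq, of "\<lambda>w. w $ r"] v(1) f by simp
    qed
  qed
qed

lemma eigenvalue_system_matrix_bound:
  assumes d: "d \<in> {1, 2, 3}" and N: "\<forall>m\<in>{1..d}. N m \<ge> 3" and a: "a > 0" and h: "h > 0"
    and pts: "distinct pts" "set pts = grid d N"
    and ev: "eigenvalue (system_matrix pts sch bc d N a s h U V) z"
  obtains y where "z = \<i> * complex_of_real (a / h\<^sup>2 * y)"
    and "\<bar>y\<bar> \<le> bound_max sch bc d N a s h U V"
proof -
  obtain f j where j: "j \<in> grid d N" "f j \<noteq> 0" and f0: "\<And>i. i \<notin> grid d N \<Longrightarrow> f i = 0"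
    and eig: "\<And>i. i \<in> grid d N \<Longrightarrow> semi_discrete_rhs sch bc d N a s h U V f i = z * f i"
    using eigenvalue_system_matrix[OF N pts ev] by metis
  show ?thesis
  \<comment> \<open>With periodic conditions there are no boundary points, so the second case
    applies.\<close>
  proof (cases "\<exists>b\<in>boundary bc d N. f b \<noteq> 0")
    case True
    then obtain b where b: "b \<in> boundary bc d N" "f b \<noteq> 0"
      by blast
    have "b \<in> grid d N"
      using b(1) boundary_subset_grid by blast
    then have "z * f b = \<i> * complex_of_real (a / h\<^sup>2 * bd_B bc a s h U V b) * f b"
      using eig[of b] b(1) by (simp add: semi_discrete_rhs_def mult.assoc)
    then have "z = \<i> * complex_of_real (a / h\<^sup>2 * bd_B bc a s h U V b)"
      using b(2) by (metis mult_right_cancel)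
    then show ?thesis
      using that bound_max_ge_B[OF b(1)] by blast
  next
    case False
    have f: "f i = 0" if "i \<notin> interior bc d N" for i
      using that False f0 by (auto simp: interior_def)
    have "j \<in> interior bc d N"
      using f j(2) by blast
    moreover have "semi_discrete_rhs sch bc d N a s h U V f i = z * f i"
      if "i \<in> interior bc d N" for i
      using that by (intro eig) (simp add: interior_def)
    ultimately show ?thesis
      using interior_spectrum_bound[where f = f and z = z and sch = sch, OF d N a h f _ j(2)] that by metis
  qed
qed

theorem mainTheorem2:
  fixes d :: nat and N :: "nat \<Rightarrow> nat" and a s h k :: real
    and U V :: "point \<Rightarrow> real"
    and sch :: scheme and bc :: boundary_condition
    and pts :: "point list"
  assumes "d \<in> {1, 2, 3}"
    and "\<forall>m\<in>{1..d}. N m \<ge> 3"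
    and "a > 0" and "h > 0"
    and "\<forall>i\<in>grid d N. U i \<ge> 0"
    and "distinct pts" and "set pts = grid d N"
    and "k > 0"
    and "k < sqrt 8 / bound_max sch bc d N a s h U V * (h\<^sup>2 / a)"
  shows "rk4_stable (system_matrix pts sch bc d N a s h U V) k"
  unfolding rk4_stable_def
proof (intro allI impI)
  fix z assume "eigenvalue (system_matrix pts sch bc d N a s h U V) z"
  then obtain y where z: "z = \<i> * complex_of_real (a / h\<^sup>2 * y)"
    and y: "\<bar>y\<bar> \<le> bound_max sch bc d N a s h U V" (is "_ \<le> ?K")
    using eigenvalue_system_matrix_bound[OF assms(1-4,6,7)] by metis
  \<comment> \<open>Division by a vanishing maximum would give the bound 0, excluded by \<open>k > 0\<close>.\<close>
  have "?K \<noteq> 0"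
    using assms(8,9) by auto
  then have K: "?K > 0"
    using y by linarith
  \<comment> \<open>The time step bound says that \<open>k * (a / h\<^sup>2) * ?K\<close> is below
    \<open>sqrt 8\<close>, the end of the RK4 stability interval on the imaginary axis.\<close>
  have "k * (a / h\<^sup>2) * \<bar>y\<bar> \<le> k * (a / h\<^sup>2) * ?K"
    using y assms(3,8) by (intro mult_left_mono) auto
  also have "\<dots> \<le> sqrt 8"
    using assms(3,4,9) K by (simp add: field_simps)
  finally have "\<bar>k * (a / h\<^sup>2 * y)\<bar> \<le> sqrt 8"
    using assms(3,8) by (simp add: abs_mult)
  then have "cmod (rk4_R (\<i> * complex_of_real (k * (a / h\<^sup>2 * y)))) \<le> 1"
    by (rule cmod_rk4_R_imaginary_le_1)
  then show "cmod (rk4_R (complex_of_real k * z)) \<le> 1"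
    by (simp add: z mult_ac)
qed

end
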